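(* Let $p\in(0,1)$ be fixed. For each $n$, let $G_0\sim \mathrm{ER}(n,p)$ on vertex set $V$ with $|V|=n$, and let $(G_t)_{t\ge 0}$ be the sequence of graphs produced by the standard edgelighter walk started from $G_0$ with parameters $1-q_1=q_2=p$ and with the walker's starting vertex chosen uniformly at random from $V$. Let $A_t$ denote the adjacency matrix of $G_t$. If $t\ge 4n^2\log n$, then for any $\beta\in(0,1)$, $G_0$ and $G_t$ are $\beta$-anonymized; specifically, $$\mathbb{P}\left[\operatorname*{arg\,max}_{Q\in\Pi_n}\operatorname{Tr}(A_0QA_tQ^T)\subset\bigcup_{k=0}^{n^\beta}\Pi_{n,k}\right]\le n^{-2}+(2n^\beta)^{1-n/(2n^\beta+1)}.$$
   Context: $\mathrm{ER}(n,p)$ is the Erdős–Rényi random graph on $n$ vertices: each of the $\binom n2$ unordered pairs is an edge independently with probability $p$. Standard edgelighter walk with parameters $q_1,q_2$: a time-homogeneous Markov chain $Z_t=(L_t,G_t)$ on $V\times\{0,1\}^{\binom V2}$, where $L_t\in V$ is the walker's position and $G_t$ is the current graph on $V$ (encoded by the indicator of its edge set). If at time $t$ the walker is at $u$, it selects $v\in V$ uniformly at random ($v=u$ allowed, probability $1/n$ each), independently of the past, and moves to $v$. If $v=u$, then $G_{t+1}=G_t$. If $v\ne u$, only the status of the pair $\{u,v\}$ may change: if $\{u,v\}$ is an edge of $G_t$, it is removed with probability $q_1$ (and kept with probability $1-q_1$); if $\{u,v\}$ is a non-edge of $G_t$, it is added with probability $q_2$ (and left absent with probability $1-q_2$). These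 random switches are independent of the walker and of the graph history. $\Pi_n$ is the set of $n\times n$ permutation matrices, and $\Pi_{n,k}$ is the set of those whose associated permutation moves (does not fix) exactly $k$ of the $n$ labels (so $\Pi_{n,0}=\{I_n\}$). The union over $k=0,\dots,n^\beta$ is over integers $0\le k\le n^\beta$. Two graphs on the same vertex set with adjacency matrices $A,B$ are called $\beta$-anonymized if $\mathbb{P}[\operatorname{arg\,max}_{P\in\Pi_n}\operatorname{Tr}(APBP^T)\subset\bigcup_{k=0}^{n^\beta}\Pi_{n,k}]=o(1)$ as $n\to\infty$; here $\operatorname{arg\,max}$ denotes the set of all maximizers. *)

theory Defs
  imports
    "HOL-Probability.Probability"
    "HOL-Library.Landau_Symbols"
    "Jordan_Normal_Form.Matrix"
begin

text \<open>
  The vertex set is \<open>{..<n}\<close>, so that vertices are also the row and column indices of matrices.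
  A graph is the indicator of its edge set, a function on unordered pairs \<open>{u, v}\<close> that is
  \<open>False\<close> outside \<open>vertex_pairs n\<close>.
\<close>

type_synonym graph = "nat set \<Rightarrow> bool"

definition vertex_pairs :: "nat \<Rightarrow> nat set set" where
  "vertex_pairs n = {e. e \<subseteq> {..<n} \<and> card e = 2}"

definition adjacency_matrix :: "nat \<Rightarrow> graph \<Rightarrow> real mat" where
  "adjacency_matrix n G = mat n n (\<lambda>(u, v). if u \<noteq> v \<and> G {u, v} then 1 else 0)"

definition ER :: "nat \<Rightarrow> real \<Rightarrow> graph pmf" where
  "ER n p = Pi_pmf (vertex_pairs n) False (\<lambda>_. bernoulli_pmf p)"


subsection \<open>The edgelighter walk\<close>

text \<open>A state is the pair of the walker's position and the current graph.\<close>

definition edgelighter_step ::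
    "nat \<Rightarrow> real \<Rightarrow> real \<Rightarrow> nat \<times> graph \<Rightarrow> (nat \<times> graph) pmf" where
  "edgelighter_step n q1 q2 = (\<lambda>(u, G).
     bind_pmf (pmf_of_set {..<n}) (\<lambda>v.
       if v = u then return_pmf (v, G)
       else map_pmf (\<lambda>b. (v, G({u, v} := b)))
              (bernoulli_pmf (if G {u, v} then 1 - q1 else q2))))"

text \<open>
  The law of the trajectory \<open>[Z\<^sub>0, \<dots>, Z\<^sub>t]\<close> of the time-homogeneous Markov chain
  with the above transition kernel and initial law \<open>init\<close>.
\<close>

primrec edgelighter_walk ::
    "nat \<Rightarrow> real \<Rightarrow> real \<Rightarrow> (nat \<times> graph) pmf \<Rightarrow> nat \<Rightarrow> (nat \<times> graph) list pmf" where
  "edgelighter_walk n q1 q2 init 0 = map_pmf (\<lambda>z. [z]) init"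
| "edgelighter_walk n q1 q2 init (Suc t) =
     bind_pmf (edgelighter_walk n q1 q2 init t) (\<lambda>zs.
       map_pmf (\<lambda>z. zs @ [z]) (edgelighter_step n q1 q2 (last zs)))"

text \<open>
  The joint law of \<open>(G\<^sub>0, G\<^sub>t)\<close> when \<open>G\<^sub>0\<close> is an Erdos--Renyi graph and the
  walker starts at an independent uniformly random vertex.
\<close>

definition edgelighter_graphs ::
    "nat \<Rightarrow> real \<Rightarrow> real \<Rightarrow> real \<Rightarrow> nat \<Rightarrow> (graph \<times> graph) pmf" where
  "edgelighter_graphs n p q1 q2 t =
     map_pmf (\<lambda>zs. (snd (zs ! 0), snd (zs ! t)))
       (edgelighter_walk n q1 q2 (pair_pmf (pmf_of_set {..<n}) (ER n p)) t)"


subsection \<open>Graph matching and anonymization\<close>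

definition mat_trace :: "real mat \<Rightarrow> real" where
  "mat_trace A = (\<Sum>i<dim_row A. A $$ (i, i))"

definition perm_mat :: "nat \<Rightarrow> (nat \<Rightarrow> nat) \<Rightarrow> real mat" where
  "perm_mat n \<pi> = mat n n (\<lambda>(i, j). if i = \<pi> j then 1 else 0)"

definition perm_mats :: "nat \<Rightarrow> real mat set" where
  "perm_mats n = {perm_mat n \<pi> | \<pi>. \<pi> permutes {..<n}}"

definition perm_mats_moving :: "nat \<Rightarrow> nat \<Rightarrow> real mat set" where
  "perm_mats_moving n k =
     {perm_mat n \<pi> | \<pi>. \<pi> permutes {..<n} \<and> card {i \<in> {..<n}. \<pi> i \<noteq> i} = k}"

definition optimal_matchings :: "nat \<Rightarrow> real mat \<Rightarrow> real mat \<Rightarrow> real mat set" where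
  "optimal_matchings n A B =
     {Q. is_arg_max (\<lambda>P. mat_trace (A * P * B * transpose_mat P)) (\<lambda>P. P \<in> perm_mats n) Q}"

definition matching_near_identity :: "nat \<Rightarrow> real \<Rightarrow> (graph \<times> graph) set" where
  "matching_near_identity n \<beta> =
     {(G, H). optimal_matchings n (adjacency_matrix n G) (adjacency_matrix n H)
                \<subseteq> (\<Union>k\<in>{k. real k \<le> real n powr \<beta>}. perm_mats_moving n k)}"

text \<open>
  Anonymization is an asymptotic property, hence a property of a sequence \<open>D\<close> where \<open>D n\<close>
  is the joint law of the two graphs on \<open>n\<close> vertices.
\<close>

definition anonymized :: "real \<Rightarrow> (nat \<Rightarrow> (graph \<times> graph) pmf) \<Rightarrow> bool" where
  "anonymized \<beta> D \<longleftrightarrow>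
     (\<lambda>n. measure_pmf.prob (D n) (matching_near_identity n \<beta>)) \<in> o(\<lambda>_. 1)"

end

theory Submission
  imports Defs "HOL-Real_Asymp.Real_Asymp"
begin

text \<open>
  Since \<open>1 - q\<^sub>1 = q\<^sub>2 = p\<close>, every traversal of a pair resamples its status from scratch. Hence, given the
  set \<open>C\<close> of traversed pairs, \<open>G\<^sub>t\<close> agrees on \<open>C\<close> with a fresh Erdos--Renyi graph \<open>H\<close> independent of
  \<open>G\<^sub>0\<close>, and with \<open>G\<^sub>0\<close> elsewhere. Looking at every other step only, a given pair is untraversed at
  time \<open>t\<close> with probability at most \<open>(1 - 2 / n\<^sup>2)\<^bsup>t / 2\<^esup> \<le> n\<^bsup>-4\<^esup>\<close>, so a union bound gives \<open>G\<^sub>t = H\<close> outside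
  an event of probability \<open>n\<^bsup>-2\<^esup>\<close>.

  For independent \<open>G\<^sub>0\<close> and \<open>H\<close>, relabelling \<open>H\<close> by a permutation \<open>\<sigma>\<close> does not change the joint law but
  translates the set of optimal matchings by \<open>\<sigma>\<close>. At most \<open>\<bar>S\<bar>\<close> of the \<open>n!\<close> translates of a nonempty
  set are contained in the set \<open>S\<close> of permutations moving at most \<open>k = \<lfloor>n\<^sup>\<beta>\<rfloor>\<close> points, so the
  probability in question is at most \<open>\<bar>S\<bar> / n! \<le> 1 / (n - k)!\<close>.
\<close>

section \<open>Relabelling graphs and the Erdos-Renyi law\<close>

text \<open>Pullback of the edge indicator: a permutation \<open>\<sigma>\<close> is an isomorphism
  from \<open>relabel \<sigma> G\<close> onto \<open>G\<close>.\<close>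

definition relabel :: "(nat \<Rightarrow> nat) \<Rightarrow> graph \<Rightarrow> graph" where
  "relabel \<sigma> G = G \<circ> image \<sigma>"

lemma finite_vertex_pairs [simp]: "finite (vertex_pairs n)"
  unfolding vertex_pairs_def by (rule finite_subset[of _ "Pow {..<n}"]) auto

lemma card_vertex_pairs: "card (vertex_pairs n) = n choose 2"
  unfolding vertex_pairs_def using n_subsets[of "{..<n}" 2] by simp

lemma doubleton_in_vertex_pairs:
  assumes "u < n" "v < n" "u \<noteq> v"
  shows "{u, v} \<in> vertex_pairs n"
  using assms by (auto simp: vertex_pairs_def)

text \<open>The edge indicators are i.i.d., and \<open>image \<sigma>\<close> merely permutes their
  index set.\<close>

lemma map_relabel_ER:
  assumes "\<sigma> permutes {..<n}"
  shows "map_pmf (relabel \<sigma>) (ER n p) = ER n p"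
proof -
  have inj: "inj \<sigma>" using assms by (rule permutes_inj)
  \<comment> \<open>Stated for every set \<open>e\<close>: the direction from left to right also
    shows that pulling back keeps the default value \<open>False\<close> outside
    \<open>vertex_pairs n\<close>.\<close>
  have iff: "\<sigma> ` e \<in> vertex_pairs n \<longleftrightarrow> e \<in> vertex_pairs n" for e
  proof -
    have "\<sigma> ` e \<subseteq> {..<n} \<longleftrightarrow> e \<subseteq> {..<n}"
      using permutes_in_image[OF assms] by blast
    moreover have "card (\<sigma> ` e) = card e"
      using inj by (meson card_image inj_on_subset subset_UNIV)
    ultimately show ?thesis by (simp add: vertex_pairs_def)
  qed
  have "bij_betw (image \<sigma>) (vertex_pairs n) (vertex_pairs n)"
  proof (rule bij_betwI')
    fix e assume e: "e \<in> vertex_pairs n"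
    have "e = \<sigma> ` (inv_into UNIV \<sigma> ` e)"
      using permutes_surj[OF assms] by (simp add: image_f_inv_f)
    with e iff[of "inv_into UNIV \<sigma> ` e"] show "\<exists>d\<in>vertex_pairs n. e = \<sigma> ` d" by metis
  qed (use iff inj in \<open>auto simp: inj_image_eq_iff\<close>)
  then show ?thesis
    unfolding ER_def relabel_def
    by (subst Pi_pmf_bij_betw[where A = "vertex_pairs n" and h = "image \<sigma>"
          and B = "vertex_pairs n"]) (auto simp: iff pmf.map_comp o_def)
qed

section \<open>Permutation matrices and optimal matchings\<close>

lemma dim_perm_mat [simp]: "dim_row (perm_mat n \<pi>) = n" "dim_col (perm_mat n \<pi>) = n"
  by (simp_all add: perm_mat_def)

lemma adjacency_matrix_carrier [simp]: "adjacency_matrix n G \<in> carrier_mat n n"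
  by (simp add: adjacency_matrix_def)

lemma adjacency_matrix_relabel:
  assumes "\<sigma> permutes {..<n}" "i < n" "j < n"
  shows "adjacency_matrix n (relabel \<sigma> G) $$ (i, j) = adjacency_matrix n G $$ (\<sigma> i, \<sigma> j)"
  using assms permutes_in_image[OF assms(1)] inj_eq[OF permutes_inj[OF assms(1)]]
  by (simp add: adjacency_matrix_def relabel_def)

text \<open>Matchings are sets of matrices while the counting is done on permutations; this passes
  from one to the other.\<close>

lemma perm_mat_inject:
  assumes "\<pi> permutes {..<n}" "\<tau> permutes {..<n}" "perm_mat n \<pi> = perm_mat n \<tau>"
  shows "\<pi> = \<tau>"
proof
  fix j
  show "\<pi> j = \<tau> j"
  proof (cases "j < n")
    case True
    have "\<pi> j < n" using permutes_in_image[OF assms(1)] True by auto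
    with True arg_cong[OF assms(3), of "\<lambda>M. M $$ (\<pi> j, j)"] show ?thesis
      by (simp add: perm_mat_def split: if_splits)
  next
    case False
    with assms(1,2) show ?thesis by (auto simp: permutes_def)
  qed
qed

text \<open>In this coordinate form of the objective, a relabelling acts by reindexing a double
  sum.\<close>

lemma mat_trace_conjugate_perm:
  assumes A: "A \<in> carrier_mat n n" and B: "B \<in> carrier_mat n n" and \<pi>: "\<pi> permutes {..<n}"
  shows "mat_trace (A * perm_mat n \<pi> * B * transpose_mat (perm_mat n \<pi>)) =
    (\<Sum>l<n. \<Sum>j<n. A $$ (\<pi> l, \<pi> j) * B $$ (j, l))"
proof -
  let ?P = "perm_mat n \<pi>"
  have \<pi>n: "\<pi> j < n" if "j < n" for j
    using permutes_in_image[OF \<pi>] that by auto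
  have AP: "(A * ?P) $$ (i, j) = A $$ (i, \<pi> j)" if "i < n" "j < n" for i j
  proof -
    have "(A * ?P) $$ (i, j) = (\<Sum>k<n. A $$ (i, k) * (if k = \<pi> j then 1 else 0))"
      using that A by (auto simp: scalar_prod_def perm_mat_def atLeast0LessThan intro!: sum.cong)
    also have "\<dots> = A $$ (i, \<pi> j)"
      using \<pi>n[OF that(2)] by (simp add: if_distrib[of "\<lambda>x. _ * x"] cong: if_cong)
    finally show ?thesis .
  qed
  have APB: "(A * ?P * B) $$ (i, l) = (\<Sum>j<n. A $$ (i, \<pi> j) * B $$ (j, l))"
    if "i < n" "l < n" for i l
  proof -
    have "(A * ?P * B) $$ (i, l) = scalar_prod (row (A * ?P) i) (col B l)"
      using that A B by (intro index_mult_mat(1)) auto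
    also have "\<dots> = (\<Sum>j<n. (A * ?P) $$ (i, j) * B $$ (j, l))"
      unfolding scalar_prod_def
      by (rule sum.cong)
        (use that A B in \<open>auto simp: atLeast0LessThan simp del: index_mult_mat(1)\<close>)
    finally show ?thesis using AP that by simp
  qed
  have "mat_trace (A * ?P * B * transpose_mat ?P) =
      (\<Sum>i<n. \<Sum>l<n. (A * ?P * B) $$ (i, l) * (if i = \<pi> l then 1 else 0))"
  proof -
    have "dim_row (A * ?P * B * transpose_mat ?P) = n" using A by simp
    moreover have "(A * ?P * B * transpose_mat ?P) $$ (i, i) =
        (\<Sum>l<n. (A * ?P * B) $$ (i, l) * (if i = \<pi> l then 1 else 0))" if "i < n" for i
    proof -
      have "(A * ?P * B * transpose_mat ?P) $$ (i, i) =
          scalar_prod (row (A * ?P * B) i) (col (transpose_mat ?P) i)"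
        using that A by (intro index_mult_mat(1)) (auto simp: perm_mat_def)
      also have "\<dots> = (\<Sum>l<n. (A * ?P * B) $$ (i, l) * (if i = \<pi> l then 1 else 0))"
        unfolding scalar_prod_def
        by (rule sum.cong)
          (use that A B in \<open>auto simp: perm_mat_def atLeast0LessThan simp del: index_mult_mat(1)\<close>)
      finally show ?thesis .
    qed
    ultimately show ?thesis by (simp add: mat_trace_def)
  qed
  also have "\<dots> = (\<Sum>l<n. \<Sum>i<n. (A * ?P * B) $$ (i, l) * (if i = \<pi> l then 1 else 0))"
    by (rule sum.swap)
  also have "\<dots> = (\<Sum>l<n. (A * ?P * B) $$ (\<pi> l, l))"
    using \<pi>n by (intro sum.cong refl) (simp add: if_distrib[of "\<lambda>x. _ * x"] cong: if_cong)
  also have "\<dots> = (\<Sum>l<n. \<Sum>j<n. A $$ (\<pi> l, \<pi> j) * B $$ (j, l))"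
    using APB \<pi>n by (intro sum.cong refl) simp
  finally show ?thesis .
qed

text \<open>Both factors of the summand are evaluated at \<open>\<sigma> l\<close> and
  \<open>\<sigma> j\<close>, so \<open>\<sigma>\<close> disappears after reindexing the two
  sums.\<close>

lemma mat_trace_relabel:
  assumes \<pi>: "\<pi> permutes {..<n}" and \<sigma>: "\<sigma> permutes {..<n}" and A: "A \<in> carrier_mat n n"
  shows "mat_trace (A * perm_mat n (\<pi> \<circ> \<sigma>) * adjacency_matrix n (relabel \<sigma> H) *
           transpose_mat (perm_mat n (\<pi> \<circ> \<sigma>))) =
         mat_trace (A * perm_mat n \<pi> * adjacency_matrix n H * transpose_mat (perm_mat n \<pi>))"
proof -
  let ?f = "\<lambda>l j. A $$ (\<pi> l, \<pi> j) * adjacency_matrix n H $$ (j, l)"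
  have "(\<Sum>l<n. \<Sum>j<n. ?f (\<sigma> l) (\<sigma> j)) = (\<Sum>l<n. \<Sum>j<n. ?f (\<sigma> l) j)"
    by (intro sum.cong refl sum.reindex_bij_betw[OF permutes_imp_bij[OF \<sigma>]])
  also have "\<dots> = (\<Sum>l<n. \<Sum>j<n. ?f l j)"
    by (rule sum.reindex_bij_betw[OF permutes_imp_bij[OF \<sigma>]])
  finally show ?thesis
    using A \<sigma> by (simp add: mat_trace_conjugate_perm permutes_compose[OF \<sigma> \<pi>] \<pi>
        adjacency_matrix_relabel)
qed

text \<open>Composing with \<open>\<sigma>\<close> on the right is a bijection of the candidates
  that preserves the objective, hence it carries maximizers to maximizers.\<close>

lemma optimal_matchings_relabel:
  assumes \<pi>: "\<pi> permutes {..<n}" and \<sigma>: "\<sigma> permutes {..<n}" and A: "A \<in> carrier_mat n n"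
    and opt: "perm_mat n \<pi> \<in> optimal_matchings n A (adjacency_matrix n H)"
  shows "perm_mat n (\<pi> \<circ> \<sigma>) \<in> optimal_matchings n A (adjacency_matrix n (relabel \<sigma> H))"
proof -
  let ?tr = "\<lambda>H P. mat_trace (A * P * adjacency_matrix n H * transpose_mat P)"
  have "?tr (relabel \<sigma> H) (perm_mat n \<tau>) \<le> ?tr (relabel \<sigma> H) (perm_mat n (\<pi> \<circ> \<sigma>))"
    if \<tau>: "\<tau> permutes {..<n}" for \<tau>
  proof -
    \<comment> \<open>A competitor \<open>\<tau>\<close> for the relabelled graph corresponds to the
      competitor \<open>\<tau> \<circ> \<sigma>^-1\<close> for \<open>H\<close>.\<close>
    have \<rho>: "\<tau> \<circ> inv_into UNIV \<sigma> permutes {..<n}"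
      using \<sigma> \<tau> by (intro permutes_compose permutes_inv)
    have \<tau>_eq: "\<tau> = (\<tau> \<circ> inv_into UNIV \<sigma>) \<circ> \<sigma>"
      using permutes_inv_o(2)[OF \<sigma>] by (simp add: o_assoc[symmetric])
    have "?tr H (perm_mat n (\<tau> \<circ> inv_into UNIV \<sigma>)) \<le> ?tr H (perm_mat n \<pi>)"
      using opt \<rho> by (auto simp: optimal_matchings_def is_arg_max_def perm_mats_def not_less)
    then show ?thesis
      using mat_trace_relabel[OF \<rho> \<sigma> A, folded \<tau>_eq] mat_trace_relabel[OF \<pi> \<sigma> A]
      by simp
  qed
  moreover have "perm_mat n (\<pi> \<circ> \<sigma>) \<in> perm_mats n"
    using permutes_compose[OF \<sigma> \<pi>] by (auto simp: perm_mats_def)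
  ultimately show ?thesis
    by (auto simp: optimal_matchings_def is_arg_max_def perm_mats_def not_less)
qed

text \<open>An empty set of maximizers would be contained in every set; the counting below needs one
  maximizer to translate.\<close>

lemma optimal_matching_exists:
  obtains \<pi> where "\<pi> permutes {..<n}" "perm_mat n \<pi> \<in> optimal_matchings n A B"
proof -
  let ?f = "\<lambda>P. mat_trace (A * P * B * transpose_mat P)"
  have eq: "perm_mats n = perm_mat n ` {\<pi>. \<pi> permutes {..<n}}"
    by (auto simp: perm_mats_def)
  have fin: "finite (perm_mats n)"
    unfolding eq by (intro finite_imageI finite_permutations) simp
  have ne: "perm_mats n \<noteq> {}"
    unfolding eq using permutes_id by blast
  have "Max (?f ` perm_mats n) \<in> ?f ` perm_mats n"
    using fin ne by (intro Max_in) auto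
  then obtain P where P: "P \<in> perm_mats n" "?f P = Max (?f ` perm_mats n)" by auto
  then have "?f Q \<le> ?f P" if "Q \<in> perm_mats n" for Q
    using fin that by simp
  then have "P \<in> optimal_matchings n A B"
    using P(1) by (auto simp: optimal_matchings_def is_arg_max_def not_less)
  with P(1) that show thesis by (auto simp: perm_mats_def)
qed

section \<open>Matching two independent graphs\<close>

text \<open>A permutation moving at most \<open>k\<close> points permutes some set \<open>K\<close>
  of exactly \<open>k\<close> points. There are \<open>card A choose k\<close> such sets with
  \<open>k!\<close> permutations each; permutations counted several times do no harm.\<close>

lemma card_permutations_moving_le:
  assumes "finite A" "k \<le> card A"
  shows "card {\<pi>. \<pi> permutes A \<and> card {i \<in> A. \<pi> i \<noteq> i} \<le> k} \<le> (card A choose k) * fact k"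
proof -
  let ?K = "{K. K \<subseteq> A \<and> card K = k}"
  have finK: "finite ?K" using assms(1) by simp
  have "{\<pi>. \<pi> permutes A \<and> card {i \<in> A. \<pi> i \<noteq> i} \<le> k} \<subseteq> (\<Union>K\<in>?K. {\<pi>. \<pi> permutes K})"
  proof safe
    fix \<pi> assume \<pi>: "\<pi> permutes A" "card {i \<in> A. \<pi> i \<noteq> i} \<le> k"
    obtain K where K: "{i \<in> A. \<pi> i \<noteq> i} \<subseteq> K" "K \<subseteq> A" "card K = k"
      using exists_subset_between[OF \<pi>(2) assms(2) _ assms(1)] by blast
    have "\<pi> permutes K"
      using \<pi>(1) K(1) by (intro permutes_superset[OF \<pi>(1)]) auto
    with K show "\<pi> \<in> (\<Union>K\<in>?K. {\<pi>. \<pi> permutes K})" by blast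
  qed
  then have "card {\<pi>. \<pi> permutes A \<and> card {i \<in> A. \<pi> i \<noteq> i} \<le> k}
      \<le> card (\<Union>K\<in>?K. {\<pi>. \<pi> permutes K})"
    using finK assms(1) by (intro card_mono) (auto intro!: finite_permutations intro: finite_subset)
  also have "\<dots> \<le> (\<Sum>K\<in>?K. card {\<pi>. \<pi> permutes K})"
    by (rule card_UN_le[OF finK])
  also have "\<dots> = (\<Sum>K\<in>?K. fact k)"
    using assms(1) by (intro sum.cong refl) (auto intro: card_permutations finite_subset)
  also have "\<dots> = (card A choose k) * fact k"
    using assms(1) by (simp add: n_subsets)
  finally show ?thesis .
qed

text \<open>Fix one optimal \<open>\<pi>\<close> for \<open>(G, H)\<close>. Then
  \<open>\<pi> \<circ> \<sigma>\<close> is optimal for \<open>(G, relabel \<sigma> H)\<close>, so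
  every counted \<open>\<sigma>\<close> makes it close to the identity, and \<open>\<sigma>\<close>
  is recovered from \<open>\<pi> \<circ> \<sigma>\<close>.\<close>

lemma card_relabellings_near_identity_le:
  "card {\<sigma>. \<sigma> permutes {..<n} \<and> (G, relabel \<sigma> H) \<in> matching_near_identity n \<beta>} \<le>
   card {\<pi>. \<pi> permutes {..<n} \<and> card {i \<in> {..<n}. \<pi> i \<noteq> i} \<le> nat \<lfloor>real n powr \<beta>\<rfloor>}"
    (is "card ?\<Sigma> \<le> card ?S")
proof -
  obtain \<pi> where \<pi>: "\<pi> permutes {..<n}"
    "perm_mat n \<pi> \<in> optimal_matchings n (adjacency_matrix n G) (adjacency_matrix n H)"
    by (rule optimal_matching_exists)
  have "\<pi> \<circ> \<sigma> \<in> ?S" if "\<sigma> \<in> ?\<Sigma>" for \<sigma>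
  proof -
    have \<sigma>: "\<sigma> permutes {..<n}"
      and near: "(G, relabel \<sigma> H) \<in> matching_near_identity n \<beta>" using that by auto
    have comp: "\<pi> \<circ> \<sigma> permutes {..<n}" by (rule permutes_compose[OF \<sigma> \<pi>(1)])
    have "perm_mat n (\<pi> \<circ> \<sigma>) \<in> (\<Union>k\<in>{k. real k \<le> real n powr \<beta>}. perm_mats_moving n k)"
      using near optimal_matchings_relabel[OF \<pi>(1) \<sigma> _ \<pi>(2)]
      by (auto simp: matching_near_identity_def)
    then obtain \<tau> where \<tau>: "\<tau> permutes {..<n}" "perm_mat n (\<pi> \<circ> \<sigma>) = perm_mat n \<tau>"
      "real (card {i \<in> {..<n}. \<tau> i \<noteq> i}) \<le> real n powr \<beta>"
      by (auto simp: perm_mats_moving_def)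
    have "\<pi> \<circ> \<sigma> = \<tau>" by (rule perm_mat_inject[OF comp \<tau>(1,2)])
    with comp \<tau>(3) show ?thesis by (auto simp: le_nat_floor)
  qed
  moreover have "inj_on ((\<circ>) \<pi>) ?\<Sigma>"
    by (auto intro!: inj_onI simp: fun_eq_iff inj_eq[OF permutes_inj[OF \<pi>(1)]])
  moreover have "finite ?S"
    by (rule finite_subset[OF _ finite_permutations[of "{..<n}"]]) auto
  ultimately show ?thesis by (intro card_inj_on_le[of "(\<circ>) \<pi>"]) auto
qed

text \<open>The left side is the expected number of events \<open>E s\<close> that occur, and this
  number never exceeds \<open>c\<close>.\<close>

lemma (in prob_space) double_counting_prob_le:
  fixes q :: real
  assumes fin: "finite S" and meas: "\<And>s. s \<in> S \<Longrightarrow> E s \<in> events"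
    and q: "\<And>s. s \<in> S \<Longrightarrow> prob (E s) = q"
    and c: "\<And>x. x \<in> space M \<Longrightarrow> card {s \<in> S. x \<in> E s} \<le> c"
  shows "card S * q \<le> c"
proof -
  have int: "integrable M (indicator (E s) :: _ \<Rightarrow> real)" if "s \<in> S" for s
    using meas[OF that] by (simp add: less_top[symmetric])
  have "card S * q = (\<Sum>s\<in>S. prob (E s))" using q by simp
  also have "\<dots> = (\<Sum>s\<in>S. \<integral>x. indicator (E s) x \<partial>M)"
    using meas by (intro sum.cong refl) (simp add: Int_absorb1 sets.sets_into_space)
  also have "\<dots> = (\<integral>x. (\<Sum>s\<in>S. indicator (E s) x) \<partial>M)"
    using int by (intro Bochner_Integration.integral_sum[symmetric])
  also have "\<dots> \<le> (\<integral>x. c \<partial>M)"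
  proof (rule integral_mono)
    fix x assume "x \<in> space M"
    have "(\<Sum>s\<in>S. indicator (E s) x :: real) = card {s \<in> S. x \<in> E s}"
      using fin by (simp add: indicator_def if_distrib sum.If_cases Int_def)
    with c[OF \<open>x \<in> space M\<close>] show "(\<Sum>s\<in>S. indicator (E s) x :: real) \<le> c" by simp
  qed (use int in \<open>auto\<close>)
  finally show ?thesis by (simp add: prob_space)
qed

text \<open>The \<open>n!\<close> events indexed by \<open>\<sigma>\<close> are equally likely, and
  at most \<open>(n choose k) * k! = n! / (n - k)!\<close> of them occur together.\<close>

lemma prob_near_identity_independent_le:
  fixes \<beta> :: real
  assumes "n \<ge> 1" "\<beta> \<le> 1"
  shows "measure_pmf.prob (pair_pmf (ER n p) (ER n p)) (matching_near_identity n \<beta>)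
           \<le> 1 / fact (n - nat \<lfloor>real n powr \<beta>\<rfloor>)"
proof -
  define k where "k = nat \<lfloor>real n powr \<beta>\<rfloor>"
  define M where "M = pair_pmf (ER n p) (ER n p)"
  have "real n powr \<beta> \<le> real n powr 1"
    using assms by (intro powr_mono) auto
  then have k: "k \<le> n" unfolding k_def using assms by (simp add: nat_le_iff floor_le_iff)
  let ?P = "{\<sigma>. \<sigma> permutes {..<n}}"
  let ?E = "\<lambda>\<sigma>. {(G, H). (G, relabel \<sigma> H) \<in> matching_near_identity n \<beta>}"
  have "card ?P * measure_pmf.prob M (matching_near_identity n \<beta>) \<le> (n choose k) * fact k"
  proof (rule measure_pmf.double_counting_prob_le[where E = ?E])
    show "finite ?P" by (simp add: finite_permutations)
    show "measure_pmf.prob M (?E \<sigma>) = measure_pmf.prob M (matching_near_identity n \<beta>)"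
      if "\<sigma> \<in> ?P" for \<sigma>
    proof -
      \<comment> \<open>By independence, relabelling the second graph alone preserves the joint
        law.\<close>
      have "map_pmf (apsnd (relabel \<sigma>)) M = M"
        using that by (simp add: M_def pair_map_pmf2[symmetric] map_relabel_ER)
      then have "measure_pmf.prob M (matching_near_identity n \<beta>) =
          measure_pmf.prob (map_pmf (apsnd (relabel \<sigma>)) M) (matching_near_identity n \<beta>)"
        by simp
      also have "\<dots> = measure_pmf.prob M (?E \<sigma>)"
        by (auto intro!: arg_cong[of _ _ "measure_pmf.prob M"])
      finally show ?thesis by simp
    qed
    show "card {\<sigma> \<in> ?P. x \<in> ?E \<sigma>} \<le> (n choose k) * fact k" for x
    proof -
      have "card {\<sigma> \<in> ?P. x \<in> ?E \<sigma>} \<le>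
          card {\<pi>. \<pi> permutes {..<n} \<and> card {i \<in> {..<n}. \<pi> i \<noteq> i} \<le> k}"
        using card_relabellings_near_identity_le[of n "fst x" "snd x" \<beta>]
        by (simp add: k_def case_prod_beta)
      also have "\<dots> \<le> (n choose k) * fact k"
        using card_permutations_moving_le[of "{..<n}" k] k by simp
      finally show ?thesis .
    qed
  qed simp
  moreover have "card ?P = fact n" by (simp add: card_permutations)
  moreover have "real ((n choose k) * fact k) = fact n / fact (n - k)"
    by (simp add: binomial_fact[OF k])
  ultimately have "fact n * measure_pmf.prob M (matching_near_identity n \<beta>) \<le> fact n / fact (n - k)"
    by (metis of_nat_fact)
  then show ?thesis
    by (simp add: field_simps M_def k_def)
qed

section \<open>The walk as resampling along traversed pairs\<close>

text \<open>Split off coordinate \<open>x\<close>: its old value is overwritten by an independent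
  draw from the same law, and the other coordinates are untouched.\<close>

lemma Pi_pmf_resample:
  assumes "finite A" "x \<in> A"
  shows "bind_pmf (Pi_pmf A d q) (\<lambda>f. map_pmf (\<lambda>b. f(x := b)) (q x)) = Pi_pmf A d q"
proof -
  have "Pi_pmf (insert x (A - {x})) d q =
      bind_pmf (q x) (\<lambda>y. bind_pmf (Pi_pmf (A - {x}) d q) (\<lambda>f. return_pmf (f(x := y))))"
    using assms by (intro Pi_pmf_insert') auto
  then have eq: "Pi_pmf A d q =
      bind_pmf (q x) (\<lambda>y. bind_pmf (Pi_pmf (A - {x}) d q) (\<lambda>f. return_pmf (f(x := y))))"
    using assms by (simp add: insert_absorb)
  show ?thesis
    by (subst (1 2) eq)
       (simp add: map_pmf_def bind_assoc_pmf bind_return_pmf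
          bind_commute_pmf[of "q x" "Pi_pmf (A - {x}) d q"])
qed

lemma ER_resample:
  assumes "e \<in> vertex_pairs n"
  shows "bind_pmf (ER n p) (\<lambda>G. map_pmf (\<lambda>b. G(e := b)) (bernoulli_pmf p)) = ER n p"
  unfolding ER_def using assms by (intro Pi_pmf_resample) auto

text \<open>The walker's position together with the pairs traversed so far. The graph is left out
  because it does not influence the moves.\<close>

primrec visited_pairs :: "nat \<Rightarrow> nat \<Rightarrow> (nat \<times> nat set set) pmf" where
  "visited_pairs n 0 = map_pmf (\<lambda>u. (u, {})) (pmf_of_set {..<n})"
| "visited_pairs n (Suc t) =
     bind_pmf (visited_pairs n t) (\<lambda>(u, C).
       map_pmf (\<lambda>v. (v, if v = u then C else insert {u, v} C)) (pmf_of_set {..<n}))"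

lemma set_visited_pairs:
  assumes "n \<ge> 1" "(u, C) \<in> set_pmf (visited_pairs n t)"
  shows "u < n"
proof -
  have "set_pmf (pmf_of_set {..<n}) = {..<n}"
    using assms(1) by (intro set_pmf_of_set) (auto simp: lessThan_empty_iff)
  moreover have "u \<in> set_pmf (pmf_of_set {..<n})"
    using assms(2) by (cases t) auto
  ultimately show ?thesis by simp
qed

lemma length_edgelighter_walk:
  "zs \<in> set_pmf (edgelighter_walk n q1 q2 init t) \<Longrightarrow> length zs = Suc t"
  by (induction t arbitrary: zs) auto

text \<open>The kernel sees only the last state, so the initial graph and the current state evolve
  by a recursion of their own, without the rest of the trajectory.\<close>

lemma edgelighter_endpoints_Suc:
  "map_pmf (\<lambda>zs. (snd (zs ! 0), zs ! Suc t)) (edgelighter_walk n q1 q2 init (Suc t)) =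
   bind_pmf (map_pmf (\<lambda>zs. (snd (zs ! 0), zs ! t)) (edgelighter_walk n q1 q2 init t))
     (\<lambda>(g, z). map_pmf (Pair g) (edgelighter_step n q1 q2 z))"
  unfolding edgelighter_walk.simps map_bind_pmf bind_map_pmf pmf.map_comp o_def prod.case
proof (rule bind_pmf_cong[OF refl])
  fix zs assume "zs \<in> set_pmf (edgelighter_walk n q1 q2 init t)"
  then have len: "length zs = Suc t" by (rule length_edgelighter_walk)
  then have "last zs = zs ! t" by (subst last_conv_nth) auto
  with len show "map_pmf (\<lambda>z. (snd ((zs @ [z]) ! 0), (zs @ [z]) ! Suc t)) (edgelighter_step n q1 q2 (last zs)) =
      map_pmf (Pair (snd (zs ! 0))) (edgelighter_step n q1 q2 (zs ! t))"
    by (simp add: nth_append)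
qed

text \<open>With \<open>q1 = 1 - p\<close> an edge survives with probability \<open>p\<close>, the
  same as for adding a non-edge: the new status ignores the old one.\<close>

lemma edgelighter_step_stationary:
  "edgelighter_step n (1 - p) p (u, G) =
     bind_pmf (pmf_of_set {..<n}) (\<lambda>v.
       if v = u then return_pmf (v, G)
       else map_pmf (\<lambda>b. (v, G({u, v} := b))) (bernoulli_pmf p))"
  by (simp add: edgelighter_step_def cong: if_cong)

text \<open>Writing \<open>b\<close> at \<open>e\<close> amounts to writing it into \<open>H\<close>
  and adding \<open>e\<close> to the overridden set; the law of \<open>H\<close> absorbs the change.
  The function \<open>f\<close> lets other data be carried along.\<close>

lemma resample_override:
  assumes "e \<in> vertex_pairs n"
  shows "bind_pmf (ER n p) (\<lambda>H. map_pmf (\<lambda>b. f ((override_on G H C)(e := b))) (bernoulli_pmf p)) =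
         map_pmf (\<lambda>H. f (override_on G H (insert e C))) (ER n p)"
proof -
  have "(override_on G H C)(e := b) = override_on G (H(e := b)) (insert e C)" for H b
    by (auto simp: override_on_def fun_eq_iff)
  then have "bind_pmf (ER n p) (\<lambda>H. map_pmf (\<lambda>b. f ((override_on G H C)(e := b))) (bernoulli_pmf p)) =
      map_pmf (\<lambda>H. f (override_on G H (insert e C)))
        (bind_pmf (ER n p) (\<lambda>H. map_pmf (\<lambda>b. H(e := b)) (bernoulli_pmf p)))"
    by (simp add: map_bind_pmf pmf.map_comp o_def)
  then show ?thesis by (simp only: ER_resample[OF assms])
qed

text \<open>A single independent copy \<open>H\<close> serves all times: even when a pair is
  traversed again, its new status is a resampled coordinate of \<open>H\<close>, which leaves the
  law of \<open>H\<close> unchanged.\<close>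

lemma edgelighter_endpoints_eq:
  assumes n: "n \<ge> 1"
  shows "map_pmf (\<lambda>zs. (snd (zs ! 0), zs ! t))
      (edgelighter_walk n (1 - p) p (pair_pmf (pmf_of_set {..<n}) (ER n p)) t) =
    bind_pmf (visited_pairs n t) (\<lambda>(u, C).
      map_pmf (\<lambda>(G, H). (G, u, override_on G H C)) (pair_pmf (ER n p) (ER n p)))"
proof (induction t)
  case 0
  show ?case
    by (simp add: pair_pmf_def map_pmf_def bind_assoc_pmf bind_return_pmf override_on_def)
next
  case (Suc t)
  have ne: "{..<n} \<noteq> {}" using n by (simp add: lessThan_empty_iff)
  let ?U = "pmf_of_set {..<n}" and ?E = "ER n p"
  let ?ins = "\<lambda>u v C. if v = u then C else insert {u, v} C"
  have step: "bind_pmf ?E (\<lambda>G. bind_pmf ?E (\<lambda>H. map_pmf (Pair G) (edgelighter_step n (1 - p) p (u, override_on G H C)))) =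
      bind_pmf ?U (\<lambda>v. bind_pmf ?E (\<lambda>G. map_pmf (\<lambda>H. (G, v, override_on G H (?ins u v C))) ?E))"
    if u: "u < n" for u C
  proof -
    \<comment> \<open>The choice of \<open>v\<close> is independent of both graphs, so it can be
      drawn first and then held fixed.\<close>
    have "bind_pmf ?E (\<lambda>G. bind_pmf ?E (\<lambda>H. map_pmf (Pair G) (edgelighter_step n (1 - p) p (u, override_on G H C)))) =
      bind_pmf ?U (\<lambda>v. bind_pmf ?E (\<lambda>G. bind_pmf ?E (\<lambda>H. map_pmf (Pair G)
        (if v = u then return_pmf (v, override_on G H C)
         else map_pmf (\<lambda>b. (v, (override_on G H C)({u, v} := b))) (bernoulli_pmf p)))))"
      unfolding edgelighter_step_stationary map_bind_pmf
      by (simp only: bind_commute_pmf[of ?E ?U])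
    also have "\<dots> = bind_pmf ?U (\<lambda>v. bind_pmf ?E (\<lambda>G. map_pmf (\<lambda>H. (G, v, override_on G H (?ins u v C))) ?E))"
    proof (intro bind_pmf_cong refl)
      fix v G assume "v \<in> set_pmf ?U"
      then have v: "v < n" using ne by simp
      show "bind_pmf ?E (\<lambda>H. map_pmf (Pair G)
        (if v = u then return_pmf (v, override_on G H C)
         else map_pmf (\<lambda>b. (v, (override_on G H C)({u, v} := b))) (bernoulli_pmf p))) =
         map_pmf (\<lambda>H. (G, v, override_on G H (?ins u v C))) ?E"
      proof (cases "v = u")
        case True
        then show ?thesis by (simp add: map_pmf_def bind_return_pmf)
      next
        case False
        with u v have "{u, v} \<in> vertex_pairs n" by (intro doubleton_in_vertex_pairs) auto
        from resample_override[OF this, of p "\<lambda>K. (G, v, K)" G C] False show ?thesis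
          by (simp add: pmf.map_comp o_def)
      qed
    qed
    finally show ?thesis .
  qed
  have bind_pair_ER: "bind_pmf (map_pmf f (pair_pmf ?E ?E)) g =
      bind_pmf ?E (\<lambda>G. bind_pmf ?E (\<lambda>H. g (f (G, H))))"
    for f :: "graph \<times> graph \<Rightarrow> 'b" and g :: "'b \<Rightarrow> 'c pmf"
    by (simp add: pair_pmf_def map_pmf_def bind_assoc_pmf bind_return_pmf)
  have map_pair_ER: "map_pmf f (pair_pmf ?E ?E) = bind_pmf ?E (\<lambda>G. map_pmf (\<lambda>H. f (G, H)) ?E)"
    for f :: "graph \<times> graph \<Rightarrow> 'b"
    by (simp add: pair_pmf_def map_pmf_def bind_assoc_pmf bind_return_pmf)
  show ?case
    unfolding edgelighter_endpoints_Suc Suc.IH visited_pairs.simps bind_assoc_pmf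
  proof (intro bind_pmf_cong refl)
    fix x assume x: "x \<in> set_pmf (visited_pairs n t)"
    obtain u C where x_eq: "x = (u, C)" by (cases x)
    have u: "u < n" using set_visited_pairs[OF n] x x_eq by blast
    show "bind_pmf (case x of (u, C) \<Rightarrow> map_pmf (\<lambda>(G, H). (G, u, override_on G H C)) (pair_pmf ?E ?E))
        (\<lambda>(g, z). map_pmf (Pair g) (edgelighter_step n (1 - p) p z)) =
      bind_pmf (case x of (u, C) \<Rightarrow> map_pmf (\<lambda>v. (v, ?ins u v C)) ?U)
        (\<lambda>(u, C). map_pmf (\<lambda>(G, H). (G, u, override_on G H C)) (pair_pmf ?E ?E))"
      unfolding x_eq prod.case bind_pair_ER unfolding bind_map_pmf map_pair_ER prod.case by (rule step[OF u])
  qed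
qed

text \<open>In this product form the traversed pairs are independent of
  \<open>(G, H)\<close>.\<close>

lemma edgelighter_graphs_eq:
  assumes "n \<ge> 1"
  shows "edgelighter_graphs n p (1 - p) p t =
    map_pmf (\<lambda>((u, C), G, H). (G, override_on G H C))
      (pair_pmf (visited_pairs n t) (pair_pmf (ER n p) (ER n p)))"
proof -
  have "edgelighter_graphs n p (1 - p) p t = map_pmf (apsnd snd)
    (map_pmf (\<lambda>zs. (snd (zs ! 0), zs ! t))
      (edgelighter_walk n (1 - p) p (pair_pmf (pmf_of_set {..<n}) (ER n p)) t))"
    by (simp add: edgelighter_graphs_def pmf.map_comp o_def)
  also have "\<dots> = bind_pmf (visited_pairs n t) (\<lambda>x.
      map_pmf (\<lambda>y. (fst y, override_on (fst y) (snd y) (snd x))) (pair_pmf (ER n p) (ER n p)))"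
    unfolding edgelighter_endpoints_eq[OF assms]
    by (simp add: map_bind_pmf pmf.map_comp o_def case_prod_beta)
  finally show ?thesis
    by (simp add: pair_pmf_def[of "visited_pairs n t"] map_bind_pmf bind_return_pmf map_pmf_def
        bind_assoc_pmf case_prod_beta)
qed

lemma set_ER_outside:
  assumes "G \<in> set_pmf (ER n p)" "e \<notin> vertex_pairs n"
  shows "\<not> G e"
  using assms set_Pi_pmf_subset[OF finite_vertex_pairs, of n False "\<lambda>_. bernoulli_pmf p"]
  by (auto simp: ER_def)

text \<open>A coupling bound: the final graph equals \<open>H\<close> as soon as every pair has been
  traversed.\<close>

lemma prob_edgelighter_graphs_le:
  assumes "n \<ge> 1"
  shows "measure_pmf.prob (edgelighter_graphs n p (1 - p) p t) X \<le>
    measure_pmf.prob (visited_pairs n t) {(u, C). \<not> vertex_pairs n \<subseteq> C} +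
    measure_pmf.prob (pair_pmf (ER n p) (ER n p)) X"
proof -
  let ?V = "visited_pairs n t" and ?E = "pair_pmf (ER n p) (ER n p)"
  let ?J = "pair_pmf ?V ?E"
  let ?N = "{(u, C). \<not> vertex_pairs n \<subseteq> C}"
  have "measure_pmf.prob (edgelighter_graphs n p (1 - p) p t) X =
      measure_pmf.prob ?J ((\<lambda>((u, C), G, H). (G, override_on G H C)) -` X)"
    by (simp add: edgelighter_graphs_eq[OF assms])
  also have "\<dots> \<le> measure_pmf.prob ?J (fst -` ?N \<union> snd -` X)"
  proof (intro measure_pmf.finite_measure_mono_AE AE_pmfI impI)
    fix x assume x: "x \<in> set_pmf ?J"
      "x \<in> (\<lambda>((u, C), G, H). (G, override_on G H C)) -` X"
    obtain u C G H where x_eq: "x = ((u, C), G, H)" by (metis prod.collapse)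
    \<comment> \<open>Outside \<open>C\<close> there are no vertex pairs left, so there both graphs
      take the default value \<open>False\<close>.\<close>
    have "override_on G H C = H" if "vertex_pairs n \<subseteq> C"
    proof
      fix e show "override_on G H C e = H e"
        using x(1) that set_ER_outside[of G n p e] set_ER_outside[of H n p e]
        by (auto simp: x_eq override_on_def)
    qed
    with x(2) show "x \<in> fst -` ?N \<union> snd -` X" by (auto simp: x_eq)
  qed auto
  also have "\<dots> \<le> measure_pmf.prob ?J (fst -` ?N) + measure_pmf.prob ?J (snd -` X)"
    by (rule measure_Un_le) auto
  also have "measure_pmf.prob ?J (fst -` ?N) = measure_pmf.prob ?V ?N"
    by (subst measure_map_pmf[symmetric]) (simp add: map_fst_pair_pmf)
  also have "measure_pmf.prob ?J (snd -` X) = measure_pmf.prob ?E X"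
    by (subst measure_map_pmf[symmetric]) (simp add: map_snd_pair_pmf)
  finally show ?thesis .
qed

section \<open>The probability that a pair stays untraversed\<close>

text \<open>Exactly two of the \<open>n^2\<close> ordered pairs, \<open>(a, b)\<close> and
  \<open>(b, a)\<close>, yield \<open>e\<close>.\<close>

lemma prob_pair_missed:
  assumes e: "e \<in> vertex_pairs n"
  shows "measure_pmf.prob (pair_pmf (pmf_of_set {..<n}) (pmf_of_set {..<n})) {(v, w). {v, w} \<noteq> e} =
    1 - 2 / (real n)\<^sup>2"
proof -
  let ?P = "pair_pmf (pmf_of_set {..<n}) (pmf_of_set {..<n})"
  obtain a b where ab: "e = {a, b}" "a \<noteq> b" "a < n" "b < n"
    using e by (auto simp: vertex_pairs_def card_2_iff)
  then have ne: "{..<n} \<noteq> {}" by auto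
  have "{(v, w). {v, w} \<noteq> e} = UNIV - {(a, b), (b, a)}"
    using ab by (auto simp: doubleton_eq_iff)
  moreover have "measure_pmf.prob ?P {(a, b), (b, a)} = 2 / (real n)\<^sup>2"
    using ab ne by (subst measure_measure_pmf_finite) (auto simp: pmf_pair power2_eq_square)
  ultimately show ?thesis
    using measure_pmf.prob_compl[of "{(a, b), (b, a)}" ?P] by simp
qed

lemma prob_pair_pmf_Times:
  "measure_pmf.prob (pair_pmf M N) (A \<times> B) = measure_pmf.prob M A * measure_pmf.prob N B"
proof -
  \<comment> \<open>Intersecting with the supports makes both factors countable, as the product
    formula requires.\<close>
  have "measure_pmf.prob (pair_pmf M N) (A \<times> B) =
      measure_pmf.prob (pair_pmf M N) ((A \<inter> set_pmf M) \<times> (B \<inter> set_pmf N))"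
    by (subst measure_Int_set_pmf[symmetric]) (simp add: Times_Int_Times)
  also have "\<dots> = measure_pmf.prob M (A \<inter> set_pmf M) * measure_pmf.prob N (B \<inter> set_pmf N)"
    by (intro measure_pmf_prob_product) auto
  finally show ?thesis by (simp add: measure_Int_set_pmf)
qed

text \<open>The chance that one step traverses \<open>e\<close> depends on the current position.
  Over two steps, the second move joins two fresh uniform vertices, independent of the past.\<close>

lemma prob_unvisited_Suc_Suc:
  assumes e: "e \<in> vertex_pairs n"
  shows "measure_pmf.prob (visited_pairs n (Suc (Suc t))) {(u, C). e \<notin> C} \<le>
    measure_pmf.prob (visited_pairs n t) {(u, C). e \<notin> C} * (1 - 2 / (real n)\<^sup>2)"
proof -
  let ?U = "pmf_of_set {..<n}"
  let ?ins = "\<lambda>u v C. if v = u then C else insert {u, v} C"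
  have "visited_pairs n (Suc (Suc t)) =
      map_pmf (\<lambda>((u, C), v, w). (w, ?ins v w (?ins u v C)))
        (pair_pmf (visited_pairs n t) (pair_pmf ?U ?U))"
    unfolding visited_pairs.simps
    by (simp add: pair_pmf_def map_pmf_def bind_assoc_pmf bind_return_pmf case_prod_beta
        cong: if_cong)
  then have "measure_pmf.prob (visited_pairs n (Suc (Suc t))) {(u, C). e \<notin> C} =
      measure_pmf.prob (pair_pmf (visited_pairs n t) (pair_pmf ?U ?U))
        ((\<lambda>((u, C), v, w). (w, ?ins v w (?ins u v C))) -` {(u, C). e \<notin> C})"
    by simp
  \<comment> \<open>The move into \<open>v\<close> is ignored. The case \<open>v = w\<close> is
    harmless, since \<open>e\<close> has two elements.\<close>
  also have "\<dots> \<le> measure_pmf.prob (pair_pmf (visited_pairs n t) (pair_pmf ?U ?U))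
        ({(u, C). e \<notin> C} \<times> {(v, w). {v, w} \<noteq> e})"
    using e by (intro measure_pmf.finite_measure_mono)
      (auto simp: vertex_pairs_def split: if_splits)
  also have "\<dots> = measure_pmf.prob (visited_pairs n t) {(u, C). e \<notin> C} * (1 - 2 / (real n)\<^sup>2)"
    by (simp only: prob_pair_pmf_Times prob_pair_missed[OF e])
  finally show ?thesis .
qed

text \<open>The start is uniform, so the very first move already joins two independent uniform
  vertices.\<close>

lemma prob_unvisited_1:
  assumes e: "e \<in> vertex_pairs n"
  shows "measure_pmf.prob (visited_pairs n (Suc 0)) {(u, C). e \<notin> C} \<le> 1 - 2 / (real n)\<^sup>2"
proof -
  let ?U = "pmf_of_set {..<n}"
  have "visited_pairs n (Suc 0) =
      map_pmf (\<lambda>(u, v). (v, if v = u then {} else {{u, v}})) (pair_pmf ?U ?U)"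
    by (simp add: pair_pmf_def map_pmf_def bind_assoc_pmf bind_return_pmf)
  then have "measure_pmf.prob (visited_pairs n (Suc 0)) {(u, C). e \<notin> C} =
      measure_pmf.prob (pair_pmf ?U ?U)
        ((\<lambda>(u, v). (v, if v = u then {} else {{u, v}})) -` {(u, C). e \<notin> C})"
    by simp
  also have "\<dots> \<le> measure_pmf.prob (pair_pmf ?U ?U) {(v, w). {v, w} \<noteq> e}"
    using e by (intro measure_pmf.finite_measure_mono)
      (auto simp: vertex_pairs_def split: if_splits)
  finally show ?thesis by (simp only: prob_pair_missed[OF e])
qed

text \<open>Every other move counts, ending with the last. The first move counts when
  \<open>t\<close> is odd, so the exponent rounds \<open>t / 2\<close> up.\<close>

lemma prob_unvisited_le:
  assumes e: "e \<in> vertex_pairs n"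
  shows "measure_pmf.prob (visited_pairs n t) {(u, C). e \<notin> C} \<le>
    (1 - 2 / (real n)\<^sup>2) ^ ((t + 1) div 2)"
proof -
  have nonneg: "0 \<le> 1 - 2 / (real n)\<^sup>2"
    using prob_pair_missed[OF e] by (metis measure_nonneg)
  show ?thesis
  proof (induction t rule: induct_nat_012)
    case 1
    then show ?case using prob_unvisited_1[OF e] by (simp del: visited_pairs.simps)
  next
    case (ge2 t)
    have "measure_pmf.prob (visited_pairs n (Suc (Suc t))) {(u, C). e \<notin> C} \<le>
        (1 - 2 / (real n)\<^sup>2) ^ ((t + 1) div 2) * (1 - 2 / (real n)\<^sup>2)"
      using prob_unvisited_Suc_Suc[OF e] mult_right_mono[OF ge2.IH(1) nonneg]
      by (rule order_trans)
    then show ?case by (simp add: mult.commute del: visited_pairs.simps)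
  qed simp
qed

text \<open>Each pair is missed with probability at most \<open>n^-4\<close>, by
  \<open>1 + x \<le> exp x\<close>, and there are at most \<open>n^2\<close> pairs.\<close>

lemma prob_not_all_visited_le:
  assumes t: "real t \<ge> 4 * (real n)\<^sup>2 * ln (real n)"
  shows "measure_pmf.prob (visited_pairs n t) {(u, C). \<not> vertex_pairs n \<subseteq> C} \<le> real n powr (-2)"
proof -
  let ?V = "visited_pairs n t"
  have single: "measure_pmf.prob ?V {(u, C). e \<notin> C} \<le> real n powr (-4)"
    if e: "e \<in> vertex_pairs n" for e
  proof -
    have n: "n > 0" using e by (cases n) (auto simp: vertex_pairs_def)
    have nonneg: "0 \<le> 1 - 2 / (real n)\<^sup>2"
      using prob_pair_missed[OF e] by (metis measure_nonneg)
    let ?m = "(t + 1) div 2"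
    have "measure_pmf.prob ?V {(u, C). e \<notin> C} \<le> (1 - 2 / (real n)\<^sup>2) ^ ?m"
      by (rule prob_unvisited_le[OF e])
    also have "\<dots> \<le> exp (- 2 / (real n)\<^sup>2) ^ ?m"
      using exp_ge_add_one_self[of "- 2 / (real n)\<^sup>2"] by (intro power_mono nonneg) simp
    also have "\<dots> = exp (- (2 * real ?m) / (real n)\<^sup>2)"
      by (simp add: exp_of_nat_mult[symmetric] mult.commute)
    also have "\<dots> \<le> exp (-4 * ln (real n))"
    proof -
      \<comment> \<open>Rounding up in \<open>?m\<close> gives the full \<open>t / 2\<close>, so the
        constant 4 yields exactly the power \<open>-4\<close>.\<close>
      have "t \<le> 2 * ?m" by presburger
      then have "real t \<le> real (2 * ?m)" by (rule of_nat_mono)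
      with t have "4 * ln (real n) * (real n)\<^sup>2 \<le> 2 * real ?m" by (simp add: algebra_simps)
      with n have "4 * ln (real n) \<le> 2 * real ?m / (real n)\<^sup>2" by (simp add: pos_le_divide_eq)
      then show ?thesis by simp
    qed
    also have "\<dots> = real n powr (-4)" using n by (simp add: powr_def)
    finally show ?thesis .
  qed
  have eq: "{(u, C). \<not> vertex_pairs n \<subseteq> C} = (\<Union>e\<in>vertex_pairs n. {(u, C). e \<notin> C})" by auto
  have "measure_pmf.prob ?V {(u, C). \<not> vertex_pairs n \<subseteq> C} \<le>
      (\<Sum>e\<in>vertex_pairs n. measure_pmf.prob ?V {(u, C). e \<notin> C})"
    unfolding eq by (rule measure_pmf.finite_measure_subadditive_finite) auto
  also have "\<dots> \<le> real (card (vertex_pairs n)) * real n powr (-4)"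
    using single by (rule sum_bounded_above)
  also have "\<dots> \<le> (real n)\<^sup>2 * real n powr (-4)"
  proof (intro mult_right_mono)
    have "n choose 2 \<le> n\<^sup>2" by (cases "2 \<le> n") (auto simp: binomial_le_pow binomial_eq_0)
    then have "real (n choose 2) \<le> real (n\<^sup>2)" by (rule of_nat_mono)
    then show "real (card (vertex_pairs n)) \<le> (real n)\<^sup>2" by (simp add: card_vertex_pairs)
  qed auto
  also have "\<dots> = real n powr (-2)"
    by (cases "n = 0") (simp_all add: powr_add[symmetric] flip: powr_numeral)
  finally show ?thesis .
qed

section \<open>The explicit bound and the conclusion\<close>

lemma two_power_le_fact: "2 ^ m \<le> (2 * fact m :: real)"
proof (induction m)
  case (Suc m)
  show ?case
  \<comment> \<open>The induction step needs \<open>2 \<le> m + 1\<close>, which fails at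
    \<open>m = 0\<close>.\<close>
  proof (cases "m = 0")
    case False
    have "2 * (2 :: real) ^ m \<le> (1 + real m) * (2 * fact m)"
      using Suc False by (intro mult_mono) auto
    then show ?thesis by (simp add: algebra_simps)
  qed simp
qed simp

text \<open>Here \<open>x\<close> stands for \<open>n^\<beta>\<close> and \<open>k\<close> for its
  floor. If the exponent \<open>e\<close> is nonnegative, the right side is at least 1. Otherwise
  \<open>1 / (n - k)! \<le> 2^(1 - (n - k)) \<le> (2^(2 * x + 1))^e\<close>, and
  \<open>2 * x \<le> 2^(2 * x + 1)\<close> finishes.\<close>

lemma inverse_fact_le_powr:
  fixes x :: real
  assumes "1 \<le> x" "real k \<le> x"
  shows "1 / fact (n - k) \<le> (2 * x) powr (1 - real n / (2 * x + 1))"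
proof (cases "real n \<le> 2 * x + 1")
  case True
  have "1 / fact (n - k) \<le> (1 :: real)" by simp
  also have "1 \<le> (2 * x) powr (1 - real n / (2 * x + 1))"
    using assms True by (intro ge_one_powr_ge_zero) (auto simp: field_simps)
  finally show ?thesis .
next
  case False
  let ?e = "1 - real n / (2 * x + 1)"
  have e: "?e \<le> 0" using assms False by (simp add: field_simps)
  have k: "k \<le> n" using assms False by linarith
  have exponent: "(2 * x + 1) * ?e = 2 * x + 1 - real n" using assms by (simp add: field_simps)
  have "1 + 2 * x * ln 2 \<le> 2 powr (2 * x)"
    using exp_ge_add_one_self[of "2 * x * ln 2"] by (simp add: powr_def)
  moreover have "2 * x * (2 / 3) \<le> 2 * x * ln 2"
    using assms ln2_ge_two_thirds by (intro mult_left_mono) auto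
  ultimately have "2 * x \<le> 2 powr (2 * x) * 2" using assms by linarith
  then have base: "2 * x \<le> 2 powr (2 * x + 1)" by (simp add: powr_add)
  have "2 ^ (n - k) / 2 \<le> (fact (n - k) :: real)"
    using two_power_le_fact[of "n - k"] by simp
  then have "1 / fact (n - k) \<le> 1 / (2 ^ (n - k) / 2 :: real)"
    by (intro divide_left_mono) auto
  also have "\<dots> = 2 powr (1 - real (n - k))"
    by (simp add: powr_diff powr_realpow)
  also have "\<dots> \<le> 2 powr ((2 * x + 1) * ?e)"
    using assms k unfolding exponent by (intro powr_mono) (auto simp: of_nat_diff)
  also have "\<dots> = (2 powr (2 * x + 1)) powr ?e"
    by (simp add: powr_powr)
  \<comment> \<open>Since \<open>?e \<le> 0\<close>, the smaller base gives the larger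
    power.\<close>
  also have "\<dots> \<le> (2 * x) powr ?e"
    using base e assms by (intro powr_mono2') auto
  finally show ?thesis .
qed

lemma prob_near_identity_le:
  fixes \<beta> :: real
  assumes "n \<ge> 1" "0 \<le> \<beta>" "\<beta> \<le> 1" "real t \<ge> 4 * (real n)\<^sup>2 * ln (real n)"
  shows "measure_pmf.prob (edgelighter_graphs n p (1 - p) p t) (matching_near_identity n \<beta>) \<le>
    real n powr (-2) + (2 * real n powr \<beta>) powr (1 - real n / (2 * real n powr \<beta> + 1))"
proof -
  have "measure_pmf.prob (pair_pmf (ER n p) (ER n p)) (matching_near_identity n \<beta>) \<le>
      1 / fact (n - nat \<lfloor>real n powr \<beta>\<rfloor>)"
    by (rule prob_near_identity_independent_le[OF assms(1,3)])
  also have "\<dots> \<le> (2 * real n powr \<beta>) powr (1 - real n / (2 * real n powr \<beta> + 1))"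
    using assms(1,2) by (intro inverse_fact_le_powr) (auto intro: ge_one_powr_ge_zero)
  finally show ?thesis
    using prob_edgelighter_graphs_le[OF assms(1), of p t "matching_near_identity n \<beta>"]
      prob_not_all_visited_le[OF assms(4)] by linarith
qed

theorem theorem2:
  fixes p q1 q2 \<beta> :: real
  assumes "0 < p" and "p < 1"
    and "1 - q1 = q2" and "q2 = p"
    and "0 < \<beta>" and "\<beta> < 1"
  shows "(\<forall>t :: nat \<Rightarrow> nat. (\<forall>n\<ge>1. real (t n) \<ge> 4 * (real n)\<^sup>2 * ln (real n)) \<longrightarrow>
            anonymized \<beta> (\<lambda>n. edgelighter_graphs n p q1 q2 (t n))) \<and>
         (\<forall>n t :: nat. n \<ge> 1 \<and> real t \<ge> 4 * (real n)\<^sup>2 * ln (real n) \<longrightarrow>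
            measure_pmf.prob (edgelighter_graphs n p q1 q2 t) (matching_near_identity n \<beta>)
              \<le> real n powr (-2) +
                (2 * real n powr \<beta>) powr (1 - real n / (2 * real n powr \<beta> + 1)))"
proof (rule conjI; intro allI impI)
  have q: "q1 = 1 - p" "q2 = p" using assms(3,4) by auto
  let ?b = "\<lambda>n. real n powr (-2) +
    (2 * real n powr \<beta>) powr (1 - real n / (2 * real n powr \<beta> + 1))"
  show bound: "measure_pmf.prob (edgelighter_graphs n p q1 q2 t) (matching_near_identity n \<beta>) \<le> ?b n"
    if "n \<ge> 1 \<and> real t \<ge> 4 * (real n)\<^sup>2 * ln (real n)" for n t :: nat
    unfolding q using that assms(5,6) by (intro prob_near_identity_le) auto
  fix t :: "nat \<Rightarrow> nat"
  assume t: "\<forall>n\<ge>1. real (t n) \<ge> 4 * (real n)\<^sup>2 * ln (real n)"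
  let ?P = "\<lambda>n. measure_pmf.prob (edgelighter_graphs n p q1 q2 (t n)) (matching_near_identity n \<beta>)"
  \<comment> \<open>As \<open>\<beta> < 1\<close>, the quotient
    \<open>n / (2 * n^\<beta> + 1)\<close> grows like \<open>n^(1 - \<beta>) / 2\<close>, so the
    exponent tends to minus infinity over a base that is at least 2.\<close>
  have "?b \<longlonglongrightarrow> 0" using assms(5,6) by real_asymp
  moreover have "\<forall>\<^sub>F n in sequentially. ?P n \<le> ?b n"
    using eventually_ge_at_top[of 1] by eventually_elim (use bound t in auto)
  ultimately have "?P \<longlonglongrightarrow> 0"
    by (intro tendsto_sandwich[of "\<lambda>_. 0" ?P sequentially ?b]) auto
  then have "(\<lambda>n. ?P n / 1) \<longlonglongrightarrow> 0" by (simp only: div_by_1)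
  then show "anonymized \<beta> (\<lambda>n. edgelighter_graphs n p q1 q2 (t n))"
    unfolding anonymized_def by (rule smalloI_tendsto) simp
qed

end
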